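(* Let $G$ be a connected simple graph. Then $$\mathrm S_G\leq\Bigl\lfloor\tfrac14\bigl(\vartheta^2(G)+2\vartheta(G)+1\bigr)\Bigr\rfloor,$$ where the right-hand side is interpreted as $+\infty$ if $\vartheta(G)=+\infty$.
   Context: $\mathbb N=\{1,2,\dots\}$. A simple graph is a finite set $X$ with $|X|>1$ together with a symmetric relation $\rho\subseteq X\times X$ such that $(x,x)\notin\rho$ for all $x$. For non-empty $U,V\subseteq X$, $S(U,V):=\{n\in\mathbb N:\rho^n(U)\cap V\neq\emptyset\}$, where $\rho^n$ is the $n$-fold composition of $\rho$; that is, $n\in S(U,V)$ iff there is a walk of length $n$ (number of edges) from some node of $U$ to some node of $V$. $\mathrm S_G$ is the cardinality of the set $\{S(U,V):\emptyset\ne U\subseteq X,\ \emptyset\neq V\subseteq X\}$. $\vartheta(G)$ denotes the smallest number, if it exists, such that any two nodes $u$ and $v$ of $G$ (the case $u=v$ included) can be connected by a walk of even length $\leq\vartheta(G)$ and by a walk of odd length $\leq\vartheta(G)$; otherwise $\vartheta(G):=+\infty$. *)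

theory Defs
  imports Complex_Main "HOL-Library.Extended_Nat"
begin

definition simple_graph :: "'a set \<Rightarrow> 'a rel \<Rightarrow> bool" where
  "simple_graph X \<rho> \<longleftrightarrow> finite X \<and> card X > 1 \<and> \<rho> \<subseteq> X \<times> X \<and> sym \<rho> \<and> irrefl \<rho>"

definition connected_graph :: "'a set \<Rightarrow> 'a rel \<Rightarrow> bool" where
  "connected_graph X \<rho> \<longleftrightarrow> (\<forall>u\<in>X. \<forall>v\<in>X. (u, v) \<in> \<rho>\<^sup>*)"

text \<open>The set of lengths of walks from \<open>U\<close> to \<open>V\<close>; there is a walk with \<open>n\<close> edges from \<open>u\<close>
  to \<open>v\<close> iff \<open>(u, v) \<in> \<rho> ^^ n\<close>. Natural numbers start at 1 in this context, so the trivial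
  walk of length 0 is not counted.\<close>

definition walk_lengths :: "'a rel \<Rightarrow> 'a set \<Rightarrow> 'a set \<Rightarrow> nat set" where
  "walk_lengths \<rho> U V = {n. n \<ge> 1 \<and> (\<rho> ^^ n) `` U \<inter> V \<noteq> {}}"

text \<open>For finite \<open>X\<close> the set below is finite, so \<open>card\<close> is its true cardinality.\<close>

definition num_walk_lengths :: "'a set \<Rightarrow> 'a rel \<Rightarrow> nat" where
  "num_walk_lengths X \<rho> =
     card {walk_lengths \<rho> U V | U V. U \<noteq> {} \<and> U \<subseteq> X \<and> V \<noteq> {} \<and> V \<subseteq> X}"

definition parity_bound :: "'a set \<Rightarrow> 'a rel \<Rightarrow> nat \<Rightarrow> bool" where
  "parity_bound X \<rho> k \<longleftrightarrow> (\<forall>u\<in>X. \<forall>v\<in>X.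
     (\<exists>n. 1 \<le> n \<and> n \<le> k \<and> even n \<and> (u, v) \<in> \<rho> ^^ n) \<and>
     (\<exists>n. 1 \<le> n \<and> n \<le> k \<and> odd n \<and> (u, v) \<in> \<rho> ^^ n))"

definition vartheta :: "'a set \<Rightarrow> 'a rel \<Rightarrow> enat" where
  "vartheta X \<rho> =
     (if \<exists>k. parity_bound X \<rho> k then enat (LEAST k. parity_bound X \<rho> k) else \<infinity>)"

end

theory Submission
  imports Defs
begin

text \<open>Retracing the first edge of a walk shows that \<open>S(U,V)\<close> is closed under adding 2, so it is
  determined by its least even and its least odd member. Both are at most \<open>t = \<vartheta>(G)\<close>, which leaves
  at most \<open>\<lfloor>t/2\<rfloor> \<sdot> \<lceil>t/2\<rceil>\<close> possibilities.\<close>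

text \<open>The pair holds the halved least even and odd members, so that bounds on those members
  become intervals of indices that can be counted directly.\<close>

definition parity_ray_union :: "nat \<times> nat \<Rightarrow> nat set" where
  "parity_ray_union p = {n. (even n \<and> 2 * fst p \<le> n) \<or> (odd n \<and> 2 * snd p + 1 \<le> n)}"

lemma add_even_closed:
  fixes A :: "nat set"
  assumes "\<And>n. n \<in> A \<Longrightarrow> n + 2 \<in> A" and "n \<in> A"
  shows "n + 2 * k \<in> A"
  by (induction k) (use assms in \<open>auto dest: assms(1) simp: algebra_simps\<close>)

text \<open>Within each parity class, steps of 2 reach everything above the least member and
  minimality excludes everything below it. The two least members thus determine \<open>A\<close>,
  and the bound \<open>t\<close> confines their indices to a finite grid.\<close>

lemma add_2_closed_in_image:
  fixes A :: "nat set"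
  assumes closed: "\<And>n. n \<in> A \<Longrightarrow> n + 2 \<in> A" and "0 \<notin> A"
    and "\<exists>n\<in>A. even n \<and> n \<le> t" and "\<exists>n\<in>A. odd n \<and> n \<le> t"
  shows "A \<in> parity_ray_union ` ({1..t div 2} \<times> {..<(t + 1) div 2})"
proof -
  define i where "i = (LEAST i. 2 * i \<in> A)"
  define j where "j = (LEAST j. 2 * j + 1 \<in> A)"
  \<comment> \<open>These witnesses serve twice: they make the two \<open>LEAST\<close> terms
    meaningful, and they bound them from above.\<close>
  obtain i' where i': "2 * i' \<in> A" "2 * i' \<le> t" using assms(3) by (auto elim!: evenE)
  obtain j' where j': "2 * j' + 1 \<in> A" "2 * j' + 1 \<le> t" using assms(4) by (auto elim!: oddE)
  have i: "2 * i \<in> A" unfolding i_def by (rule LeastI, rule i'(1))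
  have j: "2 * j + 1 \<in> A" unfolding j_def by (rule LeastI, rule j'(1))
  have i_le: "i \<le> k" if "2 * k \<in> A" for k unfolding i_def by (rule Least_le, rule that)
  have j_le: "j \<le> k" if "2 * k + 1 \<in> A" for k unfolding j_def by (rule Least_le, rule that)
  have "n \<in> A \<longleftrightarrow> n \<in> parity_ray_union (i, j)" for n
  proof (cases "even n")
    case True
    then obtain k where k: "n = 2 * k" by (elim evenE)
    have "2 * k \<in> A" if "i \<le> k"
      using add_even_closed[OF closed i, of "k - i"] that by (simp add: algebra_simps)
    then show ?thesis using i_le[of k] by (auto simp: k parity_ray_union_def)
  next
    case False
    then obtain k where k: "n = 2 * k + 1" by (elim oddE)
    have "2 * k + 1 \<in> A" if "j \<le> k"
      using add_even_closed[OF closed j, of "k - j"] that by (simp add: algebra_simps)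
    then show ?thesis using j_le[of k] by (auto simp: k parity_ray_union_def)
  qed
  then have "A = parity_ray_union (i, j)" by blast
  \<comment> \<open>Index 0 would put 0 into \<open>A\<close>. Starting at 1 leaves
    \<open>t div 2\<close> even indices instead of one more.\<close>
  moreover have "i \<noteq> 0" using i \<open>0 \<notin> A\<close> by (cases i) auto
  moreover have "i \<le> t div 2" using i_le[OF i'(1)] i'(2) by linarith
  moreover have "j < (t + 1) div 2" using j_le[OF j'(1)] j'(2) by linarith
  ultimately show ?thesis by auto
qed

text \<open>The bound applied to the pair \<open>u\<close>, \<open>u\<close> yields a closed walk of
  positive length, whose first edge leads to a neighbour.\<close>

lemma parity_bound_neighbour:
  assumes "parity_bound X \<rho> t" and "u \<in> X"
  shows "\<exists>w. (u, w) \<in> \<rho>"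
proof -
  obtain n where "1 \<le> n" "(u, u) \<in> \<rho> ^^ n" using assms unfolding parity_bound_def by blast
  then obtain m where "(u, u) \<in> \<rho> ^^ Suc m" by (cases n) auto
  then show ?thesis by (meson relpow_Suc_D2)
qed

lemma walk_lengths_add_2:
  assumes "sym \<rho>" and "parity_bound X \<rho> t" and "U \<subseteq> X" and "n \<in> walk_lengths \<rho> U V"
  shows "n + 2 \<in> walk_lengths \<rho> U V"
proof -
  obtain u v where uv: "u \<in> U" "v \<in> V" "(u, v) \<in> \<rho> ^^ n"
    using assms(4) by (auto simp: walk_lengths_def)
  \<comment> \<open>Any neighbour \<open>w\<close> of \<open>u\<close> will do, on the walk or not:
    the detour from \<open>u\<close> to \<open>w\<close> and back is put in front of the
    walk.\<close>
  obtain w where w: "(u, w) \<in> \<rho>" using parity_bound_neighbour[OF assms(2)] uv(1) assms(3) by blast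
  then have "(w, u) \<in> \<rho>" using assms(1) by (auto dest: symD)
  then have "(u, v) \<in> \<rho> ^^ Suc (Suc n)" using w uv(3) by (meson relpow_Suc_I2)
  then show ?thesis using uv(1,2) unfolding walk_lengths_def by auto
qed

lemma walk_lengths_in_image:
  assumes "sym \<rho>" and pb: "parity_bound X \<rho> t"
    and U: "U \<noteq> {}" "U \<subseteq> X" and V: "V \<noteq> {}" "V \<subseteq> X"
  shows "walk_lengths \<rho> U V \<in> parity_ray_union ` ({1..t div 2} \<times> {..<(t + 1) div 2})"
proof (rule add_2_closed_in_image)
  \<comment> \<open>A single pair suffices, since every walk from \<open>u\<close> to
    \<open>v\<close> contributes its length to the set for \<open>U\<close> and
    \<open>V\<close>.\<close>
  obtain u v where uv: "u \<in> U" "v \<in> V" using U(1) V(1) by blast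
  have mem: "n \<in> walk_lengths \<rho> U V" if "1 \<le> n" "(u, v) \<in> \<rho> ^^ n" for n
    using that uv unfolding walk_lengths_def by blast
  have "u \<in> X" "v \<in> X" using uv U(2) V(2) by auto
  then show "\<exists>n\<in>walk_lengths \<rho> U V. even n \<and> n \<le> t" "\<exists>n\<in>walk_lengths \<rho> U V. odd n \<and> n \<le> t"
    using pb mem unfolding parity_bound_def by blast+
\<comment> \<open>Closure under adding 2 and the absence of 0 remain; the latter holds because only
  lengths \<open>n \<ge> 1\<close> are counted.\<close>
qed (use walk_lengths_add_2[OF assms(1) pb U(2)] in \<open>auto simp: walk_lengths_def\<close>)

lemma num_walk_lengths_le:
  assumes "sym \<rho>" and "parity_bound X \<rho> t"
  shows "num_walk_lengths X \<rho> \<le> (t div 2) * ((t + 1) div 2)"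
proof -
  let ?I = "{1..t div 2} \<times> {..<(t + 1) div 2}"
  have "num_walk_lengths X \<rho> \<le> card (parity_ray_union ` ?I)"
    unfolding num_walk_lengths_def
    by (rule card_mono) (use walk_lengths_in_image[OF assms] in auto)
  also have "\<dots> \<le> card ?I" by (rule card_image_le) simp
  finally show ?thesis by simp
qed

theorem theorem3p9:
  fixes X :: "'a set" and \<rho> :: "'a rel"
  assumes "simple_graph X \<rho>"
    and "connected_graph X \<rho>"
  shows "enat (num_walk_lengths X \<rho>) \<le>
    (case vartheta X \<rho> of
       enat t \<Rightarrow> enat (nat \<lfloor>(1 / 4 :: real) * (real t ^ 2 + 2 * real t + 1)\<rfloor>)
     | \<infinity> \<Rightarrow> \<infinity>)"
proof (cases "\<exists>k. parity_bound X \<rho> k")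
  case True
  define t where "t = (LEAST k. parity_bound X \<rho> k)"
  have "parity_bound X \<rho> t" unfolding t_def using True by (rule LeastI_ex)
  then have le: "num_walk_lengths X \<rho> \<le> (t div 2) * ((t + 1) div 2)"
    using num_walk_lengths_le assms(1) by (auto simp: simple_graph_def)
  \<comment> \<open>Doubling each factor absorbs the divisions by 2; both doubled factors are at
    most \<open>t + 1\<close>, whose square is the polynomial in the claim.\<close>
  have "4 * ((t div 2) * ((t + 1) div 2)) = (2 * (t div 2)) * (2 * ((t + 1) div 2))" by simp
  also have "\<dots> \<le> (t + 1) * (t + 1)" by (intro mult_mono) auto
  finally have "4 * num_walk_lengths X \<rho> \<le> (t + 1) * (t + 1)" using le by linarith
  then have "real (4 * num_walk_lengths X \<rho>) \<le> real ((t + 1) * (t + 1))"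
    by (rule of_nat_mono)
  then have "real (num_walk_lengths X \<rho>) \<le> (1 / 4) * (real t ^ 2 + 2 * real t + 1)"
    by (simp add: power2_eq_square algebra_simps)
  then have "num_walk_lengths X \<rho> \<le> nat \<lfloor>(1 / 4 :: real) * (real t ^ 2 + 2 * real t + 1)\<rfloor>"
    by (rule le_nat_floor)
  then show ?thesis using True by (simp add: vartheta_def t_def)
next
  case False
  then show ?thesis by (simp add: vartheta_def)
qed

end
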